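(* Let $n,m\ge1$ be integers, $p\in(0,1)$, $q=1-p$, and let $\pi\in S_n$ with $d=\operatorname{des}(\pi)$, $a=\operatorname{asc}(\pi)$ and $v=\operatorname{vl}(\pi)$. Then $$\nu_{n, m}^{(p)}(\pi) = \frac{1}{m^n}[u^{n}]\,(1+u)^{m+v}(1+pu)^{a-v}(1+qu)^{d-v} = \frac{1}{m^n}\sum_{r=0}^{a-v}\sum_{s=0}^{d-v}\binom{a-v}{r}\binom{d-v}{s}p^rq^s\binom{m+v}{n-r-s}.$$ In particular, $(\operatorname{des}(\pi),\operatorname{vl}(\pi))$ is a sufficient statistic for the asymmetric shelf shuffle, i.e. $\nu_{n,m}^{(p)}(\pi)$ depends on $\pi\in S_n$ only through the pair $(\operatorname{des}(\pi),\operatorname{vl}(\pi))$.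
   Context: $(m,p)$-shelf shuffle (asymmetric shelf shuffle): a deck of cards labelled $1,\ldots,n$, arranged in increasing order from top to bottom, is dealt sequentially from the bottom (so the cards are dealt in the order $n,n-1,\ldots,1$). Each card is assigned one of $m$ labelled shelves, independently and uniformly at random, and is placed at the top of the existing pile on that shelf with probability $p$ and at the bottom of it with probability $q=1-p$, independently of everything else (a card assigned to an empty shelf simply starts the pile). The shuffled deck is formed by joining the piles in the order of the shelves $1,\ldots,m$, and is read from top to bottom as a permutation $\pi=(\pi_1,\ldots,\pi_n)\in S_n$ in one-line notation. The law of this random permutation is denoted $\nu_{n,m}^{(p)}$. $\operatorname{des}(\pi)=|\{i\in[n-1]:\pi_i>\pi_{i+1}\}|$, $\operatorname{asc}(\pi)=n-1-\operatorname{des}(\pi)$, $\operatorname{vl}(\pi)=|\{2\le i\le n-1:\pi_{i-1}>\pi_i<\pi_{i+1}\}|$. $[u^n]P(u)$ denotes the coefficient of $u^n$ in the polynomial $P$, and $\binom{N}{k}=0$ if $k>N$. *)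

theory Defs
  imports "HOL-Probability.Probability" "HOL-Combinatorics.Permutations"
    "HOL-Computational_Algebra.Polynomial"
begin

text \<open>
  Piles and decks are lists of cards read from top to bottom; the shelves are labelled
  \<open>1, \<dots>, m\<close>, and a configuration of the shelves maps each label to its pile.
  The flag \<open>b\<close> tells whether the card goes to the top of the pile.
\<close>

definition place_card ::
    "nat \<Rightarrow> nat \<Rightarrow> bool \<Rightarrow> (nat \<Rightarrow> nat list) \<Rightarrow> (nat \<Rightarrow> nat list)" where
  "place_card c j b S = S(j := (if b then c # S j else S j @ [c]))"

text \<open>The cards are dealt in the order in which they occur in the list.\<close>

primrec deal ::
    "nat \<Rightarrow> real \<Rightarrow> nat list \<Rightarrow> (nat \<Rightarrow> nat list) \<Rightarrow> (nat \<Rightarrow> nat list) pmf" where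
  "deal m p [] S = return_pmf S"
| "deal m p (c # cs) S =
     do {
       j \<leftarrow> pmf_of_set {1..m};
       b \<leftarrow> bernoulli_pmf p;
       deal m p cs (place_card c j b S)
     }"

definition shelf_shuffle :: "nat \<Rightarrow> nat \<Rightarrow> real \<Rightarrow> nat list pmf" where
  "shelf_shuffle n m p =
     map_pmf (\<lambda>S. concat (map S [1..<Suc m])) (deal m p (rev [1..<Suc n]) (\<lambda>_. []))"

text \<open>
  Elements of \<open>S\<^sub>n\<close> are functions \<open>\<pi>\<close> with \<open>\<pi> permutes {1..n}\<close>; the shuffled deck, read
  from top to bottom, is the one-line notation of the random permutation.
\<close>

definition one_line :: "nat \<Rightarrow> (nat \<Rightarrow> nat) \<Rightarrow> nat list" where
  "one_line n \<pi> = map \<pi> [1..<Suc n]"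

definition nu :: "nat \<Rightarrow> nat \<Rightarrow> real \<Rightarrow> (nat \<Rightarrow> nat) \<Rightarrow> real" where
  "nu n m p \<pi> = pmf (shelf_shuffle n m p) (one_line n \<pi>)"

definition des :: "nat \<Rightarrow> (nat \<Rightarrow> nat) \<Rightarrow> nat" where
  "des n \<pi> = card {i \<in> {1..n-1}. \<pi> i > \<pi> (i + 1)}"

definition asc :: "nat \<Rightarrow> (nat \<Rightarrow> nat) \<Rightarrow> nat" where
  "asc n \<pi> = n - 1 - des n \<pi>"

definition vl :: "nat \<Rightarrow> (nat \<Rightarrow> nat) \<Rightarrow> nat" where
  "vl n \<pi> = card {i \<in> {2..n-1}. \<pi> (i - 1) > \<pi> i \<and> \<pi> i < \<pi> (i + 1)}"

text \<open>
  The subtractions \<open>n - 1 - des n \<pi>\<close>, \<open>asc n \<pi> - vl n \<pi>\<close> and \<open>des n \<pi> - vl n \<pi>\<close> of natural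
  numbers never truncate for \<open>n \<ge> 1\<close>.
\<close>

lemma des_le: "des n \<pi> \<le> n - 1"
proof -
  have "des n \<pi> \<le> card {1..n-1}"
    unfolding des_def by (intro card_mono) auto
  then show ?thesis by simp
qed

lemma vl_le_des: "vl n \<pi> \<le> des n \<pi>"
proof -
  have "vl n \<pi> \<le> card {i \<in> {1..n-1}. \<pi> i > \<pi> (i + 1)}"
    unfolding vl_def
    by (rule card_inj_on_le[where f = "\<lambda>i. i - 1"]) (auto simp: inj_on_def)
  then show ?thesis by (simp add: des_def)
qed

lemma vl_le_asc: "vl n \<pi> \<le> asc n \<pi>"
proof -
  have "vl n \<pi> \<le> card ({1..n-1} - {i \<in> {1..n-1}. \<pi> i > \<pi> (i + 1)})"
    unfolding vl_def by (intro card_mono) auto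
  also have "\<dots> = asc n \<pi>"
    unfolding asc_def des_def by (subst card_Diff_subset) auto
  finally show ?thesis .
qed

end

theory Submission imports Defs begin

text \<open>
  Give every card the label \<open>(j, b)\<close> recording its shelf and whether it went to the top.
  The labels are independent, and each pile consists of its top cards in increasing order
  followed by its bottom cards in decreasing order.  So the deck is the list of all cards
  sorted by a strict linear order that depends on the labels, and it equals \<open>\<pi>\<close> exactly when
  any two neighbours in \<open>\<pi>\<close> are in that order: the labels increase weakly along \<open>\<pi>\<close> in the
  order (shelf 1 top), (shelf 1 bottom), (shelf 2 top), \<open>\<dots>\<close>, where a top label may be repeated
  only across an ascent and a bottom label only across a descent (\<open>deck_eq_iff\<close>).

  This condition can be read from left to right.  Let \<open>G\<^sub>k(j, b)\<close> be the probability that the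
  first \<open>k\<close> cards of \<open>\<pi>\<close> satisfy it and \<open>\<pi>\<^sub>k\<close> has label \<open>(j, b)\<close>.  The step from \<open>k\<close> to
  \<open>k + 1\<close> sums \<open>G\<^sub>k\<close> over the admissible preceding labels (\<open>chain_prob_Suc\<close>).  Although there are \<open>2m\<close> labels,
  one polynomial \<open>R\<^sub>k\<close> in \<open>u\<close> describes all values: with \<open>w\<close> equal to \<open>p\<close> for top labels and
  \<open>q\<close> for bottom labels,
  \<open>m\<^sup>k G\<^sub>k(j, b) = w [u\<^sup>k\<^sup>-\<^sup>1] (1 + u)\<^sup>e R\<^sub>k\<close>, where \<open>e = j - 1\<close>, except that \<open>e = j\<close> for bottom
  labels after a descent (\<open>chain_prob_eq_chain_coeff\<close>).  The reason is that summation over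
  shelves is division by \<open>u\<close>, because
  \<open>(1 + u)\<^sup>0 + \<dots> + (1 + u)\<^sup>j\<^sup>-\<^sup>1 = ((1 + u)\<^sup>j - 1) / u\<close>
  and the term \<open>-1\<close> is lost for degree reasons (\<open>sum_coeff_linear_power\<close>).

  Passing to the next card multiplies \<open>R\<^sub>k\<close> by a factor that depends only on two consecutive
  steps of \<open>\<pi>\<close>: \<open>1 + pu\<close> for ascent-ascent, \<open>1 + qu\<close> for descent-descent, \<open>1 + u\<close> for
  descent-ascent, that is for a valley, and \<open>1\<close> for ascent-descent.  The convention that fits the
  two ends is a virtual ascent before \<open>\<pi>\<^sub>1\<close> and a virtual descent after \<open>\<pi>\<^sub>n\<close>.  Counting these
  pairs gives the exponents \<open>a - v\<close>, \<open>d - v\<close> and \<open>v\<close>, and the sum over all labels adds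
  \<open>(1 + u)\<^sup>m\<close>.
\<close>

section \<open>Independent labels\<close>

definition labels :: "nat \<Rightarrow> real \<Rightarrow> (nat \<times> bool) pmf" where
  "labels m p = pair_pmf (pmf_of_set {1..m}) (bernoulli_pmf p)"

abbreviation labelling ::
    "nat \<Rightarrow> real \<Rightarrow> nat set \<Rightarrow> (nat \<Rightarrow> nat \<times> bool) pmf" where
  "labelling m p A \<equiv> Pi_pmf A undefined (\<lambda>_. labels m p)"

text \<open>
  A top card goes above everything dealt before it, a bottom card below; hence the top cards of
  a pile appear in reverse dealing order and the bottom cards in dealing order.  On the product
  measure the cards may later be revealed in any order, in particular in the order of the
  shuffled deck instead of the order of dealing.
\<close>

lemma deal_eq_labelling:
  assumes "distinct cs"
  shows "deal m p cs S =
    map_pmf (\<lambda>f j. filter (\<lambda>c. f c = (j, True)) (rev cs) @ S j @ filter (\<lambda>c. f c = (j, False)) cs)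
      (labelling m p (set cs))"
  using assms
proof (induction cs arbitrary: S)
  case Nil
  then show ?case by simp
next
  case (Cons c cs)
  let ?pile = "\<lambda>cs S f j. filter (\<lambda>c. f c = (j, True)) (rev cs) @ S j @
    filter (\<lambda>c. f c = (j, False)) cs"
  have pile: "?pile (c # cs) S (f(c := (i, b))) = ?pile cs (place_card c i b S) f" for i b f
  proof
    fix j
    have "x \<noteq> c" if "x \<in> set cs" for x
      using that Cons.prems by auto
    then show "?pile (c # cs) S (f(c := (i, b))) j = ?pile cs (place_card c i b S) f j"
      by (auto simp: place_card_def rev_filter[symmetric] cong: filter_cong)
  qed
  have "map_pmf (?pile (c # cs) S) (labelling m p (set (c # cs))) =
      pmf_of_set {1..m} \<bind> (\<lambda>i. bernoulli_pmf p \<bind> (\<lambda>b.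
        labelling m p (set cs) \<bind> (\<lambda>f. return_pmf (?pile (c # cs) S (f(c := (i, b)))))))"
    using Cons.prems
    by (simp add: Pi_pmf_insert' labels_def pair_pmf_def map_bind_pmf bind_assoc_pmf
        bind_return_pmf del: filter.simps rev.simps)
  also have "\<dots> = pmf_of_set {1..m} \<bind> (\<lambda>i. bernoulli_pmf p \<bind> (\<lambda>b.
        map_pmf (?pile cs (place_card c i b S)) (labelling m p (set cs))))"
    unfolding pile by (simp add: map_pmf_def)
  also have "\<dots> = deal m p (c # cs) S"
    using Cons.prems by (simp add: Cons.IH)
  finally show ?case ..
qed

text \<open>The list \<open>cs\<close> holds the cards in increasing order, which is the reverse of the dealing order.\<close>

definition deck :: "nat \<Rightarrow> nat list \<Rightarrow> (nat \<Rightarrow> nat \<times> bool) \<Rightarrow> nat list" where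
  "deck m cs f = concat (map (\<lambda>j. filter (\<lambda>c. f c = (j, True)) cs @
     filter (\<lambda>c. f c = (j, False)) (rev cs)) [1..<Suc m])"

lemma shelf_shuffle_eq_labelling:
  "shelf_shuffle n m p = map_pmf (deck m [1..<Suc n]) (labelling m p {1..n})"
proof -
  have "set (rev [1..<Suc n]) = {1..n}" by auto
  moreover have "distinct (rev [1..<Suc n])" by simp
  ultimately show ?thesis
    unfolding shelf_shuffle_def
    by (subst deal_eq_labelling)
       (simp_all add: map_pmf_comp deck_def[abs_def] del: upt_Suc)
qed

section \<open>The deck as a sorted list\<close>

text \<open>
  The strict order in which cards \<open>x\<close> and \<open>y\<close> with labels \<open>k\<close> and \<open>l\<close> leave the shelves: on
  each shelf first the top cards, smallest first, then the bottom cards, largest first.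
\<close>

definition precedes :: "nat \<times> bool \<Rightarrow> nat \<Rightarrow> nat \<times> bool \<Rightarrow> nat \<Rightarrow> bool" where
  "precedes k x l y \<longleftrightarrow> fst k < fst l \<or> fst k = fst l \<and>
     (if snd k then snd l \<longrightarrow> x < y else \<not> snd l \<and> y < x)"

abbreviation above :: "(nat \<Rightarrow> nat \<times> bool) \<Rightarrow> nat \<Rightarrow> nat \<Rightarrow> bool" where
  "above f x y \<equiv> precedes (f x) x (f y) y"

lemma transp_above: "transp (above f)"
  by (rule transpI) (auto simp: precedes_def split: if_splits)

lemma asymp_above: "asymp (above f)"
  by (rule asympI) (auto simp: precedes_def split: if_splits)

lemma sorted_wrt_asymp_unique:
  assumes "asymp R" "sorted_wrt R xs" "sorted_wrt R ys" "set xs = set ys"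
  shows "xs = ys"
  using assms(2-)
proof (induction xs arbitrary: ys)
  case Nil
  then show ?case by simp
next
  case (Cons x xs)
  from Cons.prems obtain y ys' where ys: "ys = y # ys'" by (cases ys) auto
  have "x = y"
    using Cons.prems asympD[OF assms(1)] unfolding ys by (auto simp: set_eq_iff) metis
  moreover have "x \<notin> set xs" "y \<notin> set ys'"
    using Cons.prems asympD[OF assms(1)] unfolding ys by (simp, blast)+
  ultimately have "set xs = set ys'"
    using Cons.prems(3) unfolding ys by auto
  with Cons \<open>x = y\<close> show ?case unfolding ys by auto
qed

lemma set_deck:
  assumes "\<And>c. c \<in> set cs \<Longrightarrow> fst (f c) \<in> {1..m}"
  shows "set (deck m cs f) = set cs"
proof
  show "set (deck m cs f) \<subseteq> set cs" by (auto simp: deck_def)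
  show "set cs \<subseteq> set (deck m cs f)"
  proof
    fix c assume c: "c \<in> set cs"
    have "f c = (fst (f c), True) \<or> f c = (fst (f c), False)"
      by (metis (full_types) prod.collapse)
    with c assms[OF c] show "c \<in> set (deck m cs f)"
      by (auto simp: deck_def intro!: bexI[of _ "fst (f c)"] simp del: upt_Suc)
  qed
qed

lemma sorted_deck:
  assumes "sorted_wrt (<) cs"
  shows "sorted_wrt (above f) (deck m cs f)"
proof (induction m)
  case 0
  then show ?case by (simp add: deck_def)
next
  case (Suc m)
  let ?T = "filter (\<lambda>c. f c = (Suc m, True)) cs"
  let ?B = "filter (\<lambda>c. f c = (Suc m, False)) (rev cs)"
  have "sorted_wrt (above f) ?T"
    using sorted_wrt_filter[OF assms]
    by (rule sorted_wrt_mono_rel[rotated]) (auto simp: precedes_def)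
  moreover have "sorted_wrt (above f) ?B"
  proof -
    have "sorted_wrt (\<lambda>x y. y < x) (rev cs)" using assms by (simp add: sorted_wrt_rev)
    from sorted_wrt_filter[OF this] show ?thesis
      by (rule sorted_wrt_mono_rel[rotated]) (auto simp: precedes_def)
  qed
  moreover have "deck (Suc m) cs f = deck m cs f @ ?T @ ?B"
    by (simp add: deck_def)
  moreover have "fst (f x) < Suc m" if "x \<in> set (deck m cs f)" for x
    using that by (auto simp: deck_def)
  ultimately show ?case
    using Suc by (auto simp: sorted_wrt_append precedes_def)
qed

text \<open>
  The deck is sorted and a sorted list is determined by its elements, so equality with \<open>w\<close>
  is sortedness of \<open>w\<close>; by transitivity only neighbours have to be compared.  This makes the
  event a chain of conditions along \<open>w\<close>.
\<close>

lemma deck_eq_iff: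
  assumes "\<And>c. c \<in> set w \<Longrightarrow> fst (f c) \<in> {1..m}" "sorted_wrt (<) cs" "set cs = set w"
  shows "deck m cs f = w \<longleftrightarrow> successively (above f) w"
proof -
  have "successively (above f) w \<longleftrightarrow> sorted_wrt (above f) w"
    by (rule successively_conv_sorted_wrt[OF transp_above])
  also have "\<dots> \<longleftrightarrow> deck m cs f = w"
  proof
    have "set (deck m cs f) = set w"
      using set_deck[of cs f m] assms(1,3) by blast
    then show "deck m cs f = w" if "sorted_wrt (above f) w"
      using sorted_wrt_asymp_unique[OF asymp_above sorted_deck[OF assms(2)] that] by simp
    show "sorted_wrt (above f) w" if "deck m cs f = w"
      using sorted_deck[OF assms(2), of f m] that by simp
  qed
  finally show ?thesis by simp
qed

lemma labelling_range:
  assumes "m \<ge> 1" "finite A" "f \<in> set_pmf (labelling m p A)" "c \<in> A"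
  shows "f c \<in> {1..m} \<times> UNIV"
proof -
  have "f c \<in> set_pmf (labels m p)"
    using assms by (auto simp: set_Pi_pmf PiE_dflt_def)
  with assms(1) show ?thesis by (auto simp: labels_def)
qed

lemma nu_eq_prob_successively:
  assumes "m \<ge> 1" "\<pi> permutes {1..n}"
  shows "nu n m p \<pi> = measure_pmf.prob (labelling m p (\<pi> ` {1..n}))
    {f. successively (above f) (one_line n \<pi>)}"
proof -
  have set: "set (one_line n \<pi>) = {1..n}"
    using permutes_image[OF assms(2)] unfolding one_line_def
    by (metis atLeastLessThanSuc_atLeastAtMost list.set_map set_upt)
  let ?M = "labelling m p {1..n}"
  have "nu n m p \<pi> = measure_pmf.prob ?M {f. deck m [1..<Suc n] f = one_line n \<pi>}"
    unfolding nu_def shelf_shuffle_eq_labelling pmf_map by (simp add: vimage_def)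
  also have "\<dots> = measure_pmf.prob ?M {f. successively (above f) (one_line n \<pi>)}"
  proof (rule measure_pmf.finite_measure_eq_AE)
    have "(deck m [1..<Suc n] f = one_line n \<pi>) = successively (above f) (one_line n \<pi>)"
      if "f \<in> set_pmf ?M" for f
    proof (rule deck_eq_iff)
      show "fst (f c) \<in> {1..m}" if c: "c \<in> set (one_line n \<pi>)" for c
        using labelling_range[OF assms(1) _ \<open>f \<in> set_pmf ?M\<close>, of c] c set by auto
      show "sorted_wrt (<) [1..<Suc n]" by (rule sorted_wrt_upt)
      show "set [1..<Suc n] = set (one_line n \<pi>)"
        unfolding set set_upt by (rule atLeastLessThanSuc_atLeastAtMost)
    qed
    then show "AE f in ?M. (f \<in> {f. deck m [1..<Suc n] f = one_line n \<pi>}) =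
        (f \<in> {f. successively (above f) (one_line n \<pi>)})"
      unfolding mem_Collect_eq by (rule AE_pmfI)
  qed simp_all
  finally show ?thesis unfolding permutes_image[OF assms(2)] .
qed

section \<open>One card at a time\<close>

definition chain_prob ::
    "nat \<Rightarrow> real \<Rightarrow> (nat \<Rightarrow> nat) \<Rightarrow> nat \<Rightarrow> nat \<times> bool \<Rightarrow> real" where
  "chain_prob m p \<pi> k l = measure_pmf.prob (labelling m p (\<pi> ` {1..k}))
     {f. successively (above f) (one_line k \<pi>) \<and> f (\<pi> k) = l}"

definition wt :: "real \<Rightarrow> bool \<Rightarrow> real" where
  "wt p b = (if b then p else 1 - p)"

lemma pmf_labels:
  assumes "m \<ge> 1" "0 \<le> p" "p \<le> 1" "l \<in> {1..m} \<times> UNIV"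
  shows "pmf (labels m p) l = wt p (snd l) / m"
  using assms by (cases "snd l") (auto simp: labels_def pmf_pair wt_def)

text \<open>
  Labellings form an uncountable type, but the supports are countable and the two sets may be
  cut down to them.
\<close>

lemma prob_pair_pmf_Times:
  "measure_pmf.prob (pair_pmf M N) (A \<times> B) = measure_pmf.prob M A * measure_pmf.prob N B"
proof -
  have "measure_pmf.prob (pair_pmf M N) (A \<times> B) =
      measure_pmf.prob (pair_pmf M N) ((A \<times> B) \<inter> set_pmf (pair_pmf M N))"
    by (rule measure_Int_set_pmf[symmetric])
  also have "(A \<times> B) \<inter> set_pmf (pair_pmf M N) = (A \<inter> set_pmf M) \<times> (B \<inter> set_pmf N)"
    by auto
  also have "measure_pmf.prob (pair_pmf M N) \<dots> = measure_pmf.prob M A * measure_pmf.prob N B"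
    by (subst measure_pmf_prob_product) (auto simp: measure_Int_set_pmf)
  finally show ?thesis .
qed

lemma prob_split_by_value:
  assumes "finite L" "\<And>f. f \<in> set_pmf M \<Longrightarrow> h f \<in> L"
  shows "measure_pmf.prob M {f. A f \<and> P (h f)} =
    (\<Sum>l | l \<in> L \<and> P l. measure_pmf.prob M {f. A f \<and> h f = l})"
proof -
  have "measure_pmf.prob M {f. A f \<and> P (h f)} =
      measure_pmf.prob M (\<Union>l\<in>{l\<in>L. P l}. {f. A f \<and> h f = l})"
    by (rule measure_pmf.finite_measure_eq_AE) (use assms(2) in \<open>auto simp: AE_measure_pmf_iff\<close>)
  also have "\<dots> = (\<Sum>l\<in>{l\<in>L. P l}. measure_pmf.prob M {f. A f \<and> h f = l})"
    by (rule measure_pmf.finite_measure_finite_Union)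
       (use assms(1) in \<open>auto simp: disjoint_family_on_def\<close>)
  finally show ?thesis .
qed

lemma one_line_Suc: "one_line (Suc k) \<pi> = one_line k \<pi> @ [\<pi> (Suc k)]"
  by (simp add: one_line_def)

lemma set_one_line: "set (one_line k \<pi>) = \<pi> ` {1..k}"
  by (auto simp: one_line_def simp del: upt_Suc)

lemma last_one_line: "k \<ge> 1 \<Longrightarrow> one_line k \<pi> \<noteq> [] \<and> last (one_line k \<pi>) = \<pi> k"
  by (cases k) (auto simp: one_line_Suc)

lemma chain_prob_1:
  assumes "m \<ge> 1" "0 \<le> p" "p \<le> 1" "l \<in> {1..m} \<times> UNIV"
  shows "chain_prob m p \<pi> 1 l = wt p (snd l) / m"
proof -
  have "chain_prob m p \<pi> 1 l =
      measure_pmf.prob (labelling m p {\<pi> 1}) ((\<lambda>f. f (\<pi> 1)) -` {l})"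
    by (simp add: chain_prob_def one_line_def vimage_def)
  also have "\<dots> = pmf (map_pmf (\<lambda>f. f (\<pi> 1)) (labelling m p {\<pi> 1})) l"
    by (simp add: pmf_map)
  also have "\<dots> = wt p (snd l) / m"
    using assms by (simp add: Pi_pmf_component pmf_labels)
  finally show ?thesis .
qed

text \<open>
  The label of the new card is independent of the earlier ones, and the new condition involves
  these only through the label of the card \<open>\<pi> k\<close>.
\<close>

lemma chain_prob_Suc:
  assumes "m \<ge> 1" "0 \<le> p" "p \<le> 1" "l \<in> {1..m} \<times> UNIV" "k \<ge> 1" "\<pi> (Suc k) \<notin> \<pi> ` {1..k}"
  shows "chain_prob m p \<pi> (Suc k) l = wt p (snd l) / m *
    (\<Sum>l' | l' \<in> {1..m} \<times> UNIV \<and> precedes l' (\<pi> k) l (\<pi> (Suc k)). chain_prob m p \<pi> k l')"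
proof -
  let ?x = "\<pi> (Suc k)" and ?M = "labelling m p (\<pi> ` {1..k})"
  let ?C = "\<lambda>f. successively (above f) (one_line k \<pi>)"
  have C_upd: "?C (f(?x := y)) = ?C f" for f y
  proof (rule successively_cong)
    have "z \<noteq> ?x" if "z \<in> set (one_line k \<pi>)" for z
      using that assms(6) unfolding set_one_line by blast
    then show "above (f(?x := y)) z z' = above f z z'"
      if "z \<in> set (one_line k \<pi>)" "z' \<in> set (one_line k \<pi>)" for z z'
      using that by simp
  qed simp
  have k_upd: "(f(?x := y)) (\<pi> k) = f (\<pi> k)" for f :: "nat \<Rightarrow> nat \<times> bool" and y
  proof -
    have "\<pi> k \<in> \<pi> ` {1..k}" using assms(5) by (intro imageI) simp
    with assms(6) have "\<pi> k \<noteq> ?x" by metis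
    then show ?thesis by simp
  qed
  have vim: "(\<lambda>(y, f). f(?x := y)) -` {f. successively (above f) (one_line (Suc k) \<pi>) \<and> f ?x = l}
      = {l} \<times> {f. ?C f \<and> precedes (f (\<pi> k)) (\<pi> k) l ?x}"
    using last_one_line[OF assms(5), of \<pi>] C_upd k_upd
    by (auto simp: one_line_Suc successively_append_iff simp del: fun_upd_apply
        simp add: fun_upd_same)
  have "\<pi> ` {1..Suc k} = insert ?x (\<pi> ` {1..k})"
    by (auto simp: atLeastAtMostSuc_conv)
  then have "labelling m p (\<pi> ` {1..Suc k}) =
      map_pmf (\<lambda>(y, f). f(?x := y)) (pair_pmf (labels m p) ?M)"
    using Pi_pmf_insert[of "\<pi> ` {1..k}" ?x] assms(6) by simp
  then have "chain_prob m p \<pi> (Suc k) l = measure_pmf.prob (pair_pmf (labels m p) ?M)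
      ({l} \<times> {f. ?C f \<and> precedes (f (\<pi> k)) (\<pi> k) l ?x})"
    by (simp only: chain_prob_def measure_map_pmf vim)
  also have "\<dots> = wt p (snd l) / m *
      measure_pmf.prob ?M {f. ?C f \<and> precedes (f (\<pi> k)) (\<pi> k) l ?x}"
    using assms(1-4) by (simp add: prob_pair_pmf_Times measure_pmf_single pmf_labels)
  also have "measure_pmf.prob ?M {f. ?C f \<and> precedes (f (\<pi> k)) (\<pi> k) l ?x} =
      (\<Sum>l' | l' \<in> {1..m} \<times> UNIV \<and> precedes l' (\<pi> k) l ?x. chain_prob m p \<pi> k l')"
    unfolding chain_prob_def
  proof (rule prob_split_by_value)
    show "f (\<pi> k) \<in> {1..m} \<times> UNIV" if "f \<in> set_pmf ?M" for f
      by (rule labelling_range[OF assms(1) _ that]) (use assms(5) in auto)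
  qed simp
  finally show ?thesis .
qed

lemma nu_eq_sum_chain_prob:
  assumes "m \<ge> 1" "n \<ge> 1" "\<pi> permutes {1..n}"
  shows "nu n m p \<pi> = (\<Sum>l\<in>{1..m} \<times> UNIV. chain_prob m p \<pi> n l)"
proof -
  have "nu n m p \<pi> = measure_pmf.prob (labelling m p (\<pi> ` {1..n}))
      {f. successively (above f) (one_line n \<pi>) \<and> True}"
    using nu_eq_prob_successively assms by simp
  also have "\<dots> = (\<Sum>l | l \<in> {1..m} \<times> UNIV \<and> True. chain_prob m p \<pi> n l)"
    unfolding chain_prob_def
  proof (rule prob_split_by_value)
    show "f (\<pi> n) \<in> {1..m} \<times> UNIV" if "f \<in> set_pmf (labelling m p (\<pi> ` {1..n}))" for f
      by (rule labelling_range[OF assms(1) _ that]) (use assms(2) in auto)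
  qed simp
  finally show ?thesis by simp
qed

text \<open>
  The labels over which a step of the recursion sums: always those of all lower shelves; on
  the shelf of the new card itself the top label across an ascent, and across a descent both
  labels or none.
\<close>

lemma precedes_set_ascent:
  assumes "x < y" "(j::nat) \<le> m" "j \<ge> 1"
  shows "{l' \<in> {1..m} \<times> UNIV. precedes l' x (j, b) y} =
    insert (j, True) ({1..<j} \<times> UNIV)"
  using assms by (auto simp: precedes_def split: if_splits)

lemma precedes_set_descent:
  assumes "y < x" "(j::nat) \<le> m" "j \<ge> 1"
  shows "{l' \<in> {1..m} \<times> UNIV. precedes l' x (j, b) y} =
    (if b then {1..<j} \<times> UNIV else {1..<Suc j} \<times> UNIV)"
  using assms by (auto simp: precedes_def split: if_splits)

section \<open>Descents and valleys of prefixes\<close>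

text \<open>
  The last step of the prefix of length \<open>k\<close> is a descent; the prefix of length 1 counts as rising.
\<close>

definition falling :: "nat \<Rightarrow> (nat \<Rightarrow> nat) \<Rightarrow> bool" where
  "falling k \<pi> \<longleftrightarrow> k \<ge> 2 \<and> \<pi> k < \<pi> (k - 1)"

lemma des_1: "des 1 \<pi> = 0" and vl_1: "vl 1 \<pi> = 0"
  by (auto simp: des_def vl_def)

lemma des_Suc:
  assumes "k \<ge> 1"
  shows "des (Suc k) \<pi> = des k \<pi> + (if \<pi> (Suc k) < \<pi> k then 1 else 0)"
proof -
  let ?D = "\<lambda>k. {i \<in> {1..k - 1}. \<pi> i > \<pi> (i + 1)}"
  have "?D (Suc k) = ?D k \<union> (if \<pi> (Suc k) < \<pi> k then {k} else {})"
    using assms by (cases k) (auto simp: le_Suc_eq)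
  moreover have "card (insert k (?D k)) = card (?D k) + 1"
    using assms by (subst card_insert_disjoint) auto
  ultimately show ?thesis unfolding des_def by simp
qed

lemma vl_Suc:
  assumes "k \<ge> 1"
  shows "vl (Suc k) \<pi> = vl k \<pi> + (if falling k \<pi> \<and> \<pi> k < \<pi> (Suc k) then 1 else 0)"
proof -
  let ?V = "\<lambda>k. {i \<in> {2..k - 1}. \<pi> (i - 1) > \<pi> i \<and> \<pi> i < \<pi> (i + 1)}"
  have "?V (Suc k) = ?V k \<union> (if falling k \<pi> \<and> \<pi> k < \<pi> (Suc k) then {k} else {})"
    using assms by (cases k) (auto simp: falling_def le_Suc_eq)
  moreover have "card (insert k (?V k)) = card (?V k) + 1"
    using assms by (subst card_insert_disjoint) auto
  ultimately show ?thesis unfolding vl_def by simp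
qed

lemma asc_Suc:
  assumes "k \<ge> 1"
  shows "asc (Suc k) \<pi> = asc k \<pi> + (if \<pi> (Suc k) < \<pi> k then 0 else 1)"
  using assms des_le[of k \<pi>] by (simp add: asc_def des_Suc)

lemma vl_less_des_if_falling:
  assumes "falling k \<pi>"
  shows "vl k \<pi> < des k \<pi>"
proof -
  obtain i where i: "k = Suc i" "i \<ge> 1"
    using assms by (cases k) (auto simp: falling_def)
  then have "vl k \<pi> = vl i \<pi>" "des k \<pi> = des i \<pi> + 1"
    using assms by (auto simp: falling_def vl_Suc des_Suc)
  with vl_le_des[of i \<pi>] show ?thesis by simp
qed

section \<open>The generating polynomial of a prefix\<close>

text \<open>
  This is the polynomial of the theorem without the factor \<open>(1 + u)\<^sup>m\<close>, for the prefix of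
  length \<open>k\<close>.
\<close>

definition stat_poly :: "real \<Rightarrow> nat \<Rightarrow> (nat \<Rightarrow> nat) \<Rightarrow> real poly" where
  "stat_poly p k \<pi> = [:1, 1:] ^ vl k \<pi> * [:1, p:] ^ (asc k \<pi> - vl k \<pi>)
     * [:1, 1 - p:] ^ (des k \<pi> - vl k \<pi>)"

text \<open>
  The polynomial \<open>R\<^sub>k\<close> of the introduction.  Every maximal run of descents contributes one factor
  \<open>1 + qu\<close> fewer than its length, and \<open>d - v\<close> takes this into account only for the runs that
  are closed by a valley; the correction treats a run that reaches the end of the prefix.
\<close>

definition prefix_poly :: "real \<Rightarrow> nat \<Rightarrow> (nat \<Rightarrow> nat) \<Rightarrow> real poly" where
  "prefix_poly p k \<pi> = [:1, 1:] ^ vl k \<pi> * [:1, p:] ^ (asc k \<pi> - vl k \<pi>)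
     * [:1, 1 - p:] ^ (des k \<pi> - vl k \<pi> - (if falling k \<pi> then 1 else 0))"

lemma stat_poly_eq_prefix_poly:
  "stat_poly p k \<pi> = prefix_poly p k \<pi> * (if falling k \<pi> then [:1, 1 - p:] else 1)"
proof (cases "falling k \<pi>")
  case True
  then obtain e where "des k \<pi> - vl k \<pi> = Suc e"
    using vl_less_des_if_falling by (metis zero_less_diff gr0_implies_Suc)
  with True show ?thesis
    by (simp only: stat_poly_def prefix_poly_def power_Suc2 if_True diff_Suc_1 mult.assoc)
qed (simp add: stat_poly_def prefix_poly_def)

lemma prefix_poly_1: "prefix_poly p 1 \<pi> = 1"
  unfolding prefix_poly_def des_1 vl_1 by (simp add: asc_def des_1[simplified] falling_def)

text \<open>
  Continuing with a descent is the same as ending with the virtual descent, so the recursion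
  is best written with \<open>stat_poly\<close>, which includes that final step.
\<close>

lemma prefix_poly_Suc_descent:
  assumes "k \<ge> 1" "\<pi> (Suc k) < \<pi> k"
  shows "prefix_poly p (Suc k) \<pi> = stat_poly p k \<pi>"
  using assms vl_le_des[of k \<pi>]
  by (simp add: prefix_poly_def stat_poly_def falling_def des_Suc vl_Suc asc_Suc)

text \<open>
  The extra summand is the contribution of the top label on the shelf of the new card.  After
  a descent the factors combine by \<open>(1 + qu) + pu = 1 + u\<close>, which is how a valley arises.
\<close>

lemma prefix_poly_Suc_ascent:
  assumes "k \<ge> 1" "\<pi> k < \<pi> (Suc k)"
  shows "prefix_poly p (Suc k) \<pi> = stat_poly p k \<pi> + [:0, p:] * prefix_poly p k \<pi>"
proof -
  let ?R = "prefix_poly p k \<pi>"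
  have "prefix_poly p (Suc k) \<pi> = (if falling k \<pi> then [:1, 1:] else [:1, p:]) * ?R"
  proof (cases "falling k \<pi>")
    case True
    then show ?thesis
      using assms by (simp add: prefix_poly_def falling_def[of "Suc k"] des_Suc vl_Suc asc_Suc
          mult.assoc del: mult_pCons_left)
  next
    case False
    have "Suc (asc k \<pi>) - vl k \<pi> = Suc (asc k \<pi> - vl k \<pi>)"
      using vl_le_asc[of k \<pi>] by simp
    with False show ?thesis
      using assms by (simp add: prefix_poly_def falling_def[of "Suc k"] des_Suc vl_Suc asc_Suc
          mult_ac del: mult_pCons_left mult_pCons_right)
  qed
  also have "\<dots> = ?R * (if falling k \<pi> then [:1, 1 - p:] else 1) + [:0, p:] * ?R"
    by (simp add: algebra_simps flip: smult_add_left)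
  finally show ?thesis by (simp only: stat_poly_eq_prefix_poly)
qed

lemma degree_linear_power_le: "degree ([:1, c:] ^ n) \<le> n" for c :: "'a :: comm_semiring_1"
  by (rule order_trans[OF degree_power_le]) simp

lemma degree_stat_poly:
  assumes "k \<ge> 1"
  shows "degree (stat_poly p k \<pi>) < k"
proof -
  have "degree (stat_poly p k \<pi>) \<le>
      vl k \<pi> + (asc k \<pi> - vl k \<pi>) + (des k \<pi> - vl k \<pi>)"
    unfolding stat_poly_def
    by (intro order_trans[OF degree_mult_le] add_mono degree_linear_power_le)
  also have "\<dots> \<le> asc k \<pi> + des k \<pi>"
    using vl_le_asc[of k \<pi>] by simp
  also have "\<dots> < k"
    using assms des_le[of k \<pi>] by (simp add: asc_def)
  finally show ?thesis .
qed

text \<open>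
  Since \<open>(1 + u)\<^sup>j\<^sup>+\<^sup>1 = (1 + u)\<^sup>j + u (1 + u)\<^sup>j\<close>, the right-hand sides have the summands as their
  differences; the degree bound gives the value 0 at \<open>j = 0\<close>.
\<close>

lemma sum_coeff_linear_power:
  fixes S :: "'a :: comm_ring_1 poly"
  assumes "degree S \<le> k"
  shows "(\<Sum>i<j. coeff ([:1, 1:] ^ i * S) k) = coeff ([:1, 1:] ^ j * S) (Suc k)"
proof (induction j)
  case 0
  then show ?case using assms by (simp add: coeff_eq_0)
next
  case (Suc j)
  have "[:1, 1:] ^ Suc j * S = [:1, 1:] ^ j * S + pCons 0 ([:1, 1:] ^ j * S)"
    by (simp add: algebra_simps)
  with Suc show ?case by simp
qed

section \<open>The transfer recursion\<close>

text \<open>The claimed value of \<open>m\<^sup>k G\<^sub>k(j, b)\<close>.\<close>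

definition chain_coeff :: "real \<Rightarrow> (nat \<Rightarrow> nat) \<Rightarrow> nat \<Rightarrow> nat \<times> bool \<Rightarrow> real" where
  "chain_coeff p \<pi> k l =
     wt p (snd l) * coeff ([:1, 1:] ^ (if falling k \<pi> \<and> \<not> snd l then fst l else fst l - 1)
       * prefix_poly p k \<pi>) (k - 1)"

text \<open>
  After a descent the exponents of the two labels differ by one, and
  \<open>p + q (1 + u) = 1 + qu\<close> is the factor by which \<open>stat_poly\<close> exceeds \<open>prefix_poly\<close>; after an
  ascent the exponents agree and \<open>p + q = 1\<close>.
\<close>

lemma chain_coeff_shelf:
  "chain_coeff p \<pi> k (Suc i, True) + chain_coeff p \<pi> k (Suc i, False) =
     coeff ([:1, 1:] ^ i * stat_poly p k \<pi>) (k - 1)"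
proof (cases "falling k \<pi>")
  case True
  let ?Z = "[:1, 1:] ^ i * prefix_poly p k \<pi>"
  have "[:1, 1:] ^ i * stat_poly p k \<pi> = [:1, 1 - p:] * ?Z"
    using True by (simp only: stat_poly_eq_prefix_poly if_True mult_ac)
  also have "[:1, 1 - p:] = smult p 1 + smult (1 - p) [:1, 1:]" by simp
  also have "\<dots> * ?Z = smult p ?Z + smult (1 - p) ([:1, 1:] * ?Z)"
    by (simp only: distrib_right mult_smult_left mult_1)
  finally have "[:1, 1:] ^ i * stat_poly p k \<pi> = smult p ?Z + smult (1 - p) ([:1, 1:] * ?Z)" .
  then show ?thesis
    using True by (simp add: chain_coeff_def wt_def mult.assoc del: mult_pCons_left)
next
  case False
  then show ?thesis
    by (simp add: chain_coeff_def wt_def stat_poly_eq_prefix_poly algebra_simps)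
qed

lemma sum_chain_coeff:
  assumes "k \<ge> 1"
  shows "(\<Sum>l\<in>{1..<Suc j} \<times> UNIV. chain_coeff p \<pi> k l) =
    coeff ([:1, 1:] ^ j * stat_poly p k \<pi>) k"
proof -
  have "(\<Sum>l\<in>{1..<Suc j} \<times> UNIV. chain_coeff p \<pi> k l) =
      (\<Sum>i\<in>{1..<Suc j}. chain_coeff p \<pi> k (i, True) + chain_coeff p \<pi> k (i, False))"
    by (simp add: sum.cartesian_product' UNIV_bool add.commute)
  also have "\<dots> = (\<Sum>i<j. chain_coeff p \<pi> k (Suc i, True) + chain_coeff p \<pi> k (Suc i, False))"
    unfolding One_nat_def sum.shift_bounds_Suc_ivl lessThan_atLeast0 ..
  also have "\<dots> = coeff ([:1, 1:] ^ j * stat_poly p k \<pi>) (Suc (k - 1))"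
    unfolding chain_coeff_shelf
    using degree_stat_poly[OF assms, of p \<pi>] by (intro sum_coeff_linear_power) simp
  finally show ?thesis using assms by simp
qed

text \<open>
  By induction on \<open>k\<close>: \<open>sum_chain_coeff\<close> evaluates the sum over the lower shelves, and the
  recursion of \<open>prefix_poly\<close> matches what the shelf of the new card adds to it.
\<close>

theorem chain_prob_eq_chain_coeff:
  assumes "m \<ge> 1" "0 \<le> p" "p \<le> 1" "k \<ge> 1" "inj_on \<pi> {1..k}" "l \<in> {1..m} \<times> UNIV"
  shows "chain_prob m p \<pi> k l = chain_coeff p \<pi> k l / m ^ k"
  using assms(4-)
proof (induction k arbitrary: l rule: nat_induct_at_least)
  case base
  then show ?case
    unfolding chain_prob_1[OF assms(1-3) base(2)] chain_coeff_def prefix_poly_1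
    by (auto simp: falling_def coeff_0_power)
next
  case (Suc k)
  obtain j b where l: "l = (j, b)" "j \<ge> 1" "j \<le> m"
    using Suc.prems(2) by auto
  obtain i where j: "j = Suc i" using l(2) by (cases j) auto
  let ?S = "stat_poly p k \<pi>" and ?R = "prefix_poly p k \<pi>"
  have new: "\<pi> (Suc k) \<notin> \<pi> ` {1..k}"
  proof
    assume "\<pi> (Suc k) \<in> \<pi> ` {1..k}"
    then obtain i where i: "i \<in> {1..k}" "\<pi> (Suc k) = \<pi> i" by blast
    with inj_onD[OF Suc.prems(1) i(2)] show False by simp
  qed
  have "inj_on \<pi> {1..k}" using Suc.prems(1) by (rule inj_on_subset) auto
  note IH = Suc.IH[OF this]
  have lower: "(\<Sum>l'\<in>{1..<Suc h} \<times> UNIV. chain_prob m p \<pi> k l') =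
      coeff ([:1, 1:] ^ h * ?S) k / m ^ k" if "h \<le> m" for h
  proof -
    have "(\<Sum>l'\<in>{1..<Suc h} \<times> UNIV. chain_prob m p \<pi> k l') =
        (\<Sum>l'\<in>{1..<Suc h} \<times> UNIV. chain_coeff p \<pi> k l' / m ^ k)"
      using that by (intro sum.cong[OF refl] IH) auto
    also have "\<dots> = coeff ([:1, 1:] ^ h * ?S) k / m ^ k"
      using sum_chain_coeff[OF Suc.hyps, of p \<pi> h] by (simp only: flip: sum_divide_distrib)
    finally show ?thesis .
  qed
  let ?prev = "\<Sum>l' | l' \<in> {1..m} \<times> UNIV \<and> precedes l' (\<pi> k) l (\<pi> (Suc k)).
    chain_prob m p \<pi> k l'"
  \<comment> \<open>The exponent in the claim for the new label; across a descent it is also the highest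
    shelf from which the previous label may come.\<close>
  let ?e = "if falling (Suc k) \<pi> \<and> \<not> b then j else j - 1"
  have prev: "?prev = coeff ([:1, 1:] ^ ?e * prefix_poly p (Suc k) \<pi>) k / m ^ k"
  proof (cases "\<pi> (Suc k) < \<pi> k")
    case True
    then have f: "falling (Suc k) \<pi>" using Suc.hyps by (simp add: falling_def)
    have "?prev = (\<Sum>l'\<in>{1..<Suc ?e} \<times> UNIV. chain_prob m p \<pi> k l')"
      unfolding l(1) precedes_set_descent[OF True l(3,2)] using f j by (intro sum.cong) auto
    also have "\<dots> = coeff ([:1, 1:] ^ ?e * ?S) k / m ^ k"
      using l j by (intro lower) auto
    finally show ?thesis unfolding prefix_poly_Suc_descent[OF Suc.hyps True] .
  next
    case False
    then have f: "\<not> falling (Suc k) \<pi>" by (simp add: falling_def)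
    have "\<pi> (Suc k) \<noteq> \<pi> k" using new Suc.hyps by force
    with False have asc: "\<pi> k < \<pi> (Suc k)" by simp
    have "?prev = chain_prob m p \<pi> k (j, True) +
        (\<Sum>l'\<in>{1..<Suc i} \<times> UNIV. chain_prob m p \<pi> k l')"
      unfolding l(1) precedes_set_ascent[OF asc l(3,2)] unfolding j
      by (subst sum.insert) auto
    also have "chain_prob m p \<pi> k (j, True) = p * coeff ([:1, 1:] ^ i * ?R) (k - 1) / m ^ k"
      using l j by (subst IH) (auto simp: chain_coeff_def wt_def)
    \<comment> \<open>A factor \<open>u\<close> raises the index of the coefficient to that of the sum over lower shelves.\<close>
    also have "p * coeff ([:1, 1:] ^ i * ?R) (k - 1) = coeff ([:1, 1:] ^ i * ([:0, p:] * ?R)) k"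
      using Suc.hyps by (cases k) auto
    also have "(\<Sum>l'\<in>{1..<Suc i} \<times> UNIV. chain_prob m p \<pi> k l') =
        coeff ([:1, 1:] ^ i * ?S) k / m ^ k"
      using l j by (intro lower) auto
    finally have "?prev = coeff ([:1, 1:] ^ i * (?S + [:0, p:] * ?R)) k / m ^ k"
      unfolding distrib_left coeff_add add_divide_distrib by (simp only: add.commute)
    then show ?thesis
      unfolding prefix_poly_Suc_ascent[OF Suc.hyps asc] using f j by simp
  qed
  have "chain_prob m p \<pi> (Suc k) l = wt p b / m * ?prev"
    using chain_prob_Suc[of m p l k \<pi>] assms(1-3) Suc.prems(2) Suc.hyps new l(1) by simp
  then show ?case
    unfolding prev by (simp add: chain_coeff_def l(1))
qed

theorem nu_eq_coeff:
  assumes "n \<ge> 1" "m \<ge> 1" "0 \<le> p" "p \<le> 1" "\<pi> permutes {1..n}"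
  shows "nu n m p \<pi> = coeff ([:1, 1:] ^ m * stat_poly p n \<pi>) n / m ^ n"
proof -
  have "nu n m p \<pi> = (\<Sum>l\<in>{1..<Suc m} \<times> UNIV. chain_coeff p \<pi> n l / m ^ n)"
    unfolding nu_eq_sum_chain_prob[OF assms(2,1,5)] atLeastLessThanSuc_atLeastAtMost
    by (intro sum.cong refl chain_prob_eq_chain_coeff assms permutes_inj_on[OF assms(5)])
  also have "\<dots> = coeff ([:1, 1:] ^ m * stat_poly p n \<pi>) n / m ^ n"
    using sum_chain_coeff[OF assms(1), of p \<pi> m] by (simp only: flip: sum_divide_distrib)
  finally show ?thesis .
qed

section \<open>Expanding the coefficient\<close>

lemma linear_power_eq_sum_monom:
  "[:1, c:] ^ n = (\<Sum>r=0..n. monom (of_nat (n choose r) * c ^ r) r)" for c :: "'a :: comm_semiring_1"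
proof -
  have "[:1, c:] ^ n = (monom c 1 + 1) ^ n" by (simp add: monom_altdef one_pCons)
  also have "\<dots> = (\<Sum>r=0..n. monom (of_nat (n choose r) * c ^ r) r)"
    unfolding binomial_ring atLeast0AtMost
    by (intro sum.cong refl) (simp add: monom_power of_nat_poly smult_monom)
  finally show ?thesis .
qed

lemma coeff_linear_powers:
  fixes p q :: real
  assumes "A + B \<le> n"
  shows "coeff ([:1, 1:] ^ N * [:1, p:] ^ A * [:1, q:] ^ B) n =
    (\<Sum>r=0..A. \<Sum>s=0..B. real (A choose r) * real (B choose s) * p ^ r * q ^ s
       * real (N choose (n - r - s)))"
proof -
  have "[:1, 1:] ^ N * [:1, p:] ^ A * [:1, q:] ^ B = [:1, p:] ^ A * ([:1, q:] ^ B * [:1, 1:] ^ N)"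
    by (simp only: mult_ac)
  also have "\<dots> = (\<Sum>r=0..A. \<Sum>s=0..B. monom (real (A choose r) * p ^ r) r *
      (monom (real (B choose s) * q ^ s) s * [:1, 1:] ^ N))"
    unfolding linear_power_eq_sum_monom[of p] linear_power_eq_sum_monom[of q]
      sum_distrib_right[of _ _ "[:1, 1:] ^ N"] by (rule sum_product)
  finally have "coeff ([:1, 1:] ^ N * [:1, p:] ^ A * [:1, q:] ^ B) n =
      coeff (\<Sum>r=0..A. \<Sum>s=0..B. monom (real (A choose r) * p ^ r) r *
        (monom (real (B choose s) * q ^ s) s * [:1, 1:] ^ N)) n"
    by (rule arg_cong)
  also have "\<dots> = (\<Sum>r=0..A. \<Sum>s=0..B. real (A choose r) * real (B choose s) * p ^ r * q ^ s
       * real (N choose (n - r - s)))"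
    unfolding coeff_sum
  proof (intro sum.cong refl)
    fix r s assume "r \<in> {0..A}" "s \<in> {0..B}"
    with assms have "r + s \<le> n" "\<not> n - r < s" by auto
    moreover have "coeff ([:1, 1:] ^ N) h = real (N choose h)" for h
      by (simp add: linear_power_eq_sum_monom coeff_sum)
    ultimately show "coeff (monom (real (A choose r) * p ^ r) r *
          (monom (real (B choose s) * q ^ s) s * [:1, 1:] ^ N)) n =
        real (A choose r) * real (B choose s) * p ^ r * q ^ s * real (N choose (n - r - s))"
      by (simp add: coeff_monom_mult)
  qed
  finally show ?thesis .
qed

text \<open>
  The three factors of the polynomial have exponents that are functions of the descent and valley
  numbers, as \<open>a = n - 1 - d\<close>; this is the sufficiency.
\<close>

theorem corollary1p4:
  fixes n m :: nat and p q :: real and \<pi> :: "nat \<Rightarrow> nat" and d a v :: nat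
  assumes "n \<ge> 1" and "m \<ge> 1"
    and "0 < p" and "p < 1" and "q = 1 - p"
    and "\<pi> permutes {1..n}"
    and "d = des n \<pi>" and "a = asc n \<pi>" and "v = vl n \<pi>"
  shows "nu n m p \<pi> =
           1 / real m ^ n *
             coeff ([:1, 1:] ^ (m + v) * [:1, p:] ^ (a - v) * [:1, q:] ^ (d - v)) n
         \<and> 1 / real m ^ n *
             coeff ([:1, 1:] ^ (m + v) * [:1, p:] ^ (a - v) * [:1, q:] ^ (d - v)) n =
           1 / real m ^ n *
             (\<Sum>r=0..a-v. \<Sum>s=0..d-v.
                real ((a - v) choose r) * real ((d - v) choose s) * p ^ r * q ^ s
                  * real ((m + v) choose (n - r - s)))
         \<and> (\<exists>f :: nat \<times> nat \<Rightarrow> real.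
             \<forall>\<sigma>. \<sigma> permutes {1..n} \<longrightarrow> nu n m p \<sigma> = f (des n \<sigma>, vl n \<sigma>))"
proof -
  define F where "F = (\<lambda>(d, v). 1 / real m ^ n *
    coeff ([:1, 1:] ^ (m + v) * [:1, p:] ^ (n - 1 - d - v) * [:1, q:] ^ (d - v)) n)"
  have F: "nu n m p \<sigma> = F (des n \<sigma>, vl n \<sigma>)" if "\<sigma> permutes {1..n}" for \<sigma>
    using nu_eq_coeff[OF assms(1,2) _ _ that, of p] assms(3-5)
    by (simp add: F_def stat_poly_def asc_def power_add mult.assoc)
  have "(a - v) + (d - v) \<le> n"
    using des_le[of n \<pi>] assms(7,8) by (simp add: asc_def)
  note expand = coeff_linear_powers[OF this, of "m + v" p q]
  have "nu n m p \<pi> = 1 / real m ^ n *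
      coeff ([:1, 1:] ^ (m + v) * [:1, p:] ^ (a - v) * [:1, q:] ^ (d - v)) n"
    using F[OF assms(6)] assms(7-9) by (simp add: F_def asc_def)
  with F expand show ?thesis by auto
qed

end
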